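(* Let $(X_0,X_1)$ be a compatible couple of Banach function spaces. (A) Let $F_0$ be a Banach lattice over $((0,\infty),dt/t)$. Assume that the function $\Xi(t):=\|\min(\cdot,t)\|_{F_0}$, $t\in(0,\infty)$, satisfies $\Xi(1)<\infty$. If $\phi$ is the generalized reverse function of $\Xi$, then $$K(f,t;(X_0,X_1)_{F_0},X_1)\approx\|K(f,s;X_0,X_1)\chi_{(0,\phi(t))}(s)\|_{F_0}+K(f,\phi(t);X_0,X_1)\,\|\chi_{(\phi(t),\infty)}(s)\|_{F_0}$$ for all $t\in(\Xi(0),\Xi(\infty))$ and $f\in(X_0,X_1)_{F_0}+X_1$. (B) Let $F_1$ be a Banach lattice over $((0,\infty),dt/t)$ (with $\|\min(\cdot,1)\|_{F_1}<\infty$). Assume that the function $\Theta(t):=t/\|\min(\cdot,t)\|_{F_1}$, $t\in(0,\infty)$, satisfies $\Theta(1)<\infty$. If $\psi$ is the generalized reverse function of $\Theta$, then $$K(f,t;X_0,(X_0,X_1)_{F_1})\approx t\,\frac{K(f,\psi(t);X_0,X_1)}{\psi(t)}\|s\,\chi_{(0,\psi(t))}(s)\|_{F_1}+t\,\|K(f,s;X_0,X_1)\chi_{(\psi(t),\infty)}(s)\|_{F_1}$$ for all $t\in(\Theta(0),\Theta(\infty))$ and $f\in X_0+(X_0,X_1)_{F_1}$.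
   Context: Banach function spaces are in the sense of Bennett–Sharpley (over a totally $\sigma$-finite non-atomic measure space). For a compatible couple $(X,Y)$, $f\in X+Y$, $t>0$: $K(f,t;X,Y):=\inf_{f=f_1+f_2}(\|f_1\|_X+t\|f_2\|_Y)$, with infimum over $f_1\in X$, $f_2\in Y$. A Banach (function) lattice $F$ over $((0,\infty),dt/t)$ is a Banach space of real-valued measurable functions on $(0,\infty)$ such that $|f|\le|g|$ a.e. with $g\in F$ implies $f\in F$ and $\|f\|_F\le\|g\|_F$; for $f \notin F$ put $\|f\|_F=\infty$. All Banach lattices considered satisfy $\|\min(1,\cdot)\|_F<\infty$. The variable inside $\|\cdot\|_F$ is $s$. The space $(X,Y)_F$ is the set of all $f\in X+Y$ with $\|f\|_{(X,Y)_F}:=\|K(f,\cdot;X,Y)\|_F<\infty$. For a non-decreasing $\xi:(a,b)\to\mathbb{R}$ with $\xi(a)=\lim_{t\to a+}\xi(t)$, $\xi(b)=\lim_{t\to b-}\xi(t)$, the generalized reverse function is $(\mathrm{R}\xi)(t):=\inf\{\tau\in(a,b):\xi(\tau)>t\}$ for $t\in(\xi(a),\xi(b))$; here $(a,b)=(0,\infty)$. $\mathcal A\approx\mathcal B$ means $c^{-1}\mathcal B\le\mathcal A\le c\,\mathcal B$ with $c>0$ independent of $f$ and $t$; $\chi_E$ is the characteristic function of $E$. *)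

theory Defs
  imports "HOL-Analysis.Analysis"
begin

section \<open>Banach function spaces\<close>

definition non_atomic :: "'a measure \<Rightarrow> bool" where
  "non_atomic M \<longleftrightarrow>
     (\<forall>A\<in>sets M. emeasure M A > 0 \<longrightarrow>
        (\<exists>B\<in>sets M. B \<subseteq> A \<and> 0 < emeasure M B \<and> emeasure M B < emeasure M A))"

text \<open>Axioms (P1)-(P5) of Bennett and Sharpley, Chapter 1, Definition 1.1. Only the values of
  \<open>\<rho>\<close> on measurable functions matter.\<close>

locale banach_function_norm = sigma_finite_measure M
  for M :: "'a measure" +
  fixes \<rho> :: "('a \<Rightarrow> ennreal) \<Rightarrow> ennreal"
  assumes eq_0_iff: "f \<in> borel_measurable M \<Longrightarrow> \<rho> f = 0 \<longleftrightarrow> (AE x in M. f x = 0)"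
    and scale: "f \<in> borel_measurable M \<Longrightarrow> a \<ge> 0 \<Longrightarrow> \<rho> (\<lambda>x. ennreal a * f x) = ennreal a * \<rho> f"
    and triangle: "f \<in> borel_measurable M \<Longrightarrow> g \<in> borel_measurable M \<Longrightarrow>
          \<rho> (\<lambda>x. f x + g x) \<le> \<rho> f + \<rho> g"
    and mono: "f \<in> borel_measurable M \<Longrightarrow> g \<in> borel_measurable M \<Longrightarrow>
          (AE x in M. g x \<le> f x) \<Longrightarrow> \<rho> g \<le> \<rho> f"
    and fatou: "(\<And>n. u n \<in> borel_measurable M) \<Longrightarrow> f \<in> borel_measurable M \<Longrightarrow>
          (AE x in M. incseq (\<lambda>n. u n x) \<and> (\<lambda>n. u n x) \<longlonglongrightarrow> f x) \<Longrightarrow>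
          (\<lambda>n. \<rho> (u n)) \<longlonglongrightarrow> \<rho> f"
    and indicator_finite: "E \<in> sets M \<Longrightarrow> emeasure M E < \<infinity> \<Longrightarrow> \<rho> (indicator E) < \<infinity>"
    and integral_bound: "E \<in> sets M \<Longrightarrow> emeasure M E < \<infinity> \<Longrightarrow>
          \<exists>C>0. \<forall>f\<in>borel_measurable M. (\<integral>\<^sup>+x\<in>E. f x \<partial>M) \<le> ennreal C * \<rho> f"

text \<open>A space of functions is given throughout by its norm, which takes the value \<open>\<infinity>\<close> exactly
  off the space. Functions are not quotiented by equality almost everywhere; the norms do not
  distinguish almost everywhere equal measurable functions.\<close>

definition space_of :: "('f \<Rightarrow> ennreal) \<Rightarrow> 'f set" where
  "space_of N = {f. N f < \<infinity>}"

text \<open>The sort of scalars is inhabited precisely by (copies of) the real and the complex numbers.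
  Extended-valued functions with finite norm are finite almost everywhere, so finite-valued
  representatives suffice.\<close>

definition bfs_norm ::
  "'a measure \<Rightarrow> (('a \<Rightarrow> ennreal) \<Rightarrow> ennreal) \<Rightarrow> ('a \<Rightarrow> 'k::{real_normed_field,euclidean_space}) \<Rightarrow> ennreal"
where
  "bfs_norm M \<rho> f =
     (if f \<in> borel_measurable M then \<rho> (\<lambda>x. ennreal (norm (f x))) else \<infinity>)"

section \<open>The K-functional\<close>

text \<open>Two Banach function spaces over the same measure space always form a compatible couple:
  by \<open>integral_bound\<close> both embed continuously into the Hausdorff space of (classes of)
  almost everywhere finite measurable functions with convergence in measure on sets of finite
  measure. Sums and decompositions are therefore those of functions.\<close>

definition sum_space ::
  "(('a \<Rightarrow> 'k::ab_group_add) \<Rightarrow> ennreal) \<Rightarrow> (('a \<Rightarrow> 'k) \<Rightarrow> ennreal) \<Rightarrow> ('a \<Rightarrow> 'k) set" where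
  "sum_space X Y = {f. \<exists>f1\<in>space_of X. \<exists>f2\<in>space_of Y. f = (\<lambda>x. f1 x + f2 x)}"

definition K_fun ::
  "(('a \<Rightarrow> 'k::ab_group_add) \<Rightarrow> ennreal) \<Rightarrow> (('a \<Rightarrow> 'k) \<Rightarrow> ennreal) \<Rightarrow> ('a \<Rightarrow> 'k) \<Rightarrow> real \<Rightarrow> ennreal"
where
  "K_fun X Y f t =
     Inf {X f1 + ennreal t * Y f2 | f1 f2.
            f1 \<in> space_of X \<and> f2 \<in> space_of Y \<and> f = (\<lambda>x. f1 x + f2 x)}"

section \<open>Banach lattices over the half-line and interpolation spaces\<close>

definition dt_over_t :: "real measure" where
  "dt_over_t = density (lebesgue_on {0<..}) (\<lambda>t. ennreal (1 / t))"

locale banach_lattice =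
  fixes F :: "(real \<Rightarrow> real) \<Rightarrow> ennreal"
  assumes measurable: "F f < \<infinity> \<Longrightarrow> f \<in> borel_measurable dt_over_t"
    and eq_0_iff: "f \<in> borel_measurable dt_over_t \<Longrightarrow> F f = 0 \<longleftrightarrow> (AE s in dt_over_t. f s = 0)"
    and scale: "F f < \<infinity> \<Longrightarrow> F (\<lambda>s. a * f s) = ennreal \<bar>a\<bar> * F f"
    and triangle: "F f < \<infinity> \<Longrightarrow> F g < \<infinity> \<Longrightarrow> F (\<lambda>s. f s + g s) \<le> F f + F g"
    and ideal: "f \<in> borel_measurable dt_over_t \<Longrightarrow> F g < \<infinity> \<Longrightarrow>
          (AE s in dt_over_t. \<bar>f s\<bar> \<le> \<bar>g s\<bar>) \<Longrightarrow> F f \<le> F g"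
    and complete: "(\<And>n. F (u n) < \<infinity>) \<Longrightarrow>
          (\<And>e::real. e > 0 \<Longrightarrow> \<exists>n0. \<forall>m\<ge>n0. \<forall>n\<ge>n0. F (\<lambda>s. u m s - u n s) < ennreal e) \<Longrightarrow>
          \<exists>f. F f < \<infinity> \<and> (\<lambda>n. F (\<lambda>s. u n s - f s)) \<longlonglongrightarrow> 0"

text \<open>On \<open>sum_space X Y\<close> the K-functional is finite, so \<open>enn2real\<close> loses nothing there.\<close>

definition interp_norm ::
  "(('a \<Rightarrow> 'k::ab_group_add) \<Rightarrow> ennreal) \<Rightarrow> (('a \<Rightarrow> 'k) \<Rightarrow> ennreal) \<Rightarrow> ((real \<Rightarrow> real) \<Rightarrow> ennreal)
     \<Rightarrow> ('a \<Rightarrow> 'k) \<Rightarrow> ennreal"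
where
  "interp_norm X Y F f =
     (if f \<in> sum_space X Y then F (\<lambda>s. enn2real (K_fun X Y f s)) else \<infinity>)"

section \<open>Generalized reverse functions and parameter functions\<close>

text \<open>For functions on \<open>(0, \<infinity>)\<close>. The codomain is extended so that finiteness of \<open>Xi\<close> and
  \<open>Theta\<close> below can be a hypothesis.\<close>

definition val_0 :: "(real \<Rightarrow> ennreal) \<Rightarrow> ennreal" where
  "val_0 \<xi> = Lim (at_right 0) \<xi>"

definition val_inf :: "(real \<Rightarrow> ennreal) \<Rightarrow> ennreal" where
  "val_inf \<xi> = Lim at_top \<xi>"

definition gen_reverse :: "(real \<Rightarrow> ennreal) \<Rightarrow> real \<Rightarrow> real" where
  "gen_reverse \<xi> t = Inf {\<tau>. 0 < \<tau> \<and> \<xi> \<tau> > ennreal t}"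

definition Xi :: "((real \<Rightarrow> real) \<Rightarrow> ennreal) \<Rightarrow> real \<Rightarrow> ennreal" where
  "Xi F t = F (\<lambda>s. min s t)"

text \<open>In \<open>ennreal\<close>, \<open>t / 0 = \<infinity>\<close> for \<open>t > 0\<close>.\<close>

definition Theta :: "((real \<Rightarrow> real) \<Rightarrow> ennreal) \<Rightarrow> real \<Rightarrow> ennreal" where
  "Theta F t = ennreal t / F (\<lambda>s. min s t)"

end

theory Submission
  imports Defs
begin

text \<open>
  Both parts are Holmstedt's formula, proved by cutting at the point \<open>\<tau>\<close> that the reverse
  function assigns to \<open>t\<close>. Write \<open>K(f,s)\<close> for the K-functional of the original couple and \<open>\<chi>\<close>
  for characteristic functions. Since \<open>Xi F\<close> and \<open>Theta F\<close> are quasi-concave, they are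
  continuous, and \<open>\<tau> = \<phi>(t)\<close> solves \<open>Xi F \<tau> = t\<close>, while \<open>\<tau> = \<psi>(t)\<close> solves
  \<open>Theta F \<tau> = t\<close> (\<open>gen_reverse_right_inverse\<close>). Up to the factor \<open>2\<close>, the norm
  \<open>Xi F \<tau>\<close> of \<open>min s \<tau>\<close> is the sum of the norm of \<open>s \<chi>(0,\<tau>)\<close> and \<open>\<tau>\<close> times the norm of
  \<open>\<chi>(\<tau>,\<infinity>)\<close>.

  For the upper bounds, a decomposition \<open>f = f0 + f1\<close> that is competitive for \<open>K(f,\<tau>)\<close> is also
  competitive for the new couple. In the first part, \<open>K(f0,s)\<close> is at most the norm of \<open>f0\<close> for
  \<open>s > \<tau>\<close>, and at most \<open>K(f,s)\<close> plus \<open>s\<close> times the norm of \<open>f1\<close> for \<open>s < \<tau>\<close>; the cost of the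
  decomposition appears only in terms that are linear in it, so passing to the infimum replaces it
  by \<open>K(f,\<tau>)\<close> (\<open>le_affine_K_fun\<close>). What remains is absorbed because \<open>K(f,s)\<close> is non-decreasing
  and \<open>K(f,s)/s\<close> is non-increasing in \<open>s\<close>. For the lower bounds, the right-hand side is
  subadditive in \<open>f\<close>, and each of its terms is dominated on both summands of a decomposition.
  The second part is the mirror image, with the two sides of \<open>\<tau>\<close> exchanged.

  All estimates have absolute constants, so the constant of equivalence can be taken to be \<open>3\<close>
  for every couple and every lattice.
\<close>

section \<open>Continuity of quasi-concave functions and the generalized reverse function\<close>

lemma val_0_eq_INF:
  fixes \<xi> :: "real \<Rightarrow> ennreal"
  assumes mono: "\<And>a b. 0 < a \<Longrightarrow> a \<le> b \<Longrightarrow> \<xi> a \<le> \<xi> b"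
  shows "val_0 \<xi> = (INF \<tau>\<in>{0<..}. \<xi> \<tau>)"
  unfolding val_0_def
proof (rule tendsto_Lim)
  show "at_right (0::real) \<noteq> bot" by simp
  show "(\<xi> \<longlongrightarrow> (INF \<tau>\<in>{0<..}. \<xi> \<tau>)) (at_right 0)"
  proof (rule order_tendstoI)
    fix a assume "a < (INF \<tau>\<in>{0<..}. \<xi> \<tau>)"
    then have "a < \<xi> \<tau>" if "\<tau> > 0" for \<tau>
      using that by (meson INF_lower greaterThan_iff less_le_trans)
    then show "\<forall>\<^sub>F x in at_right 0. a < \<xi> x"
      by (auto simp: eventually_at_right_field intro: exI[of _ 1])
  next
    fix a assume "(INF \<tau>\<in>{0<..}. \<xi> \<tau>) < a"
    then obtain \<tau> where \<tau>: "\<tau> > 0" "\<xi> \<tau> < a" by (auto simp: INF_less_iff)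
    then have "\<xi> x < a" if "0 < x" "x < \<tau>" for x
      using mono[of x \<tau>] that by auto
    then show "\<forall>\<^sub>F x in at_right 0. \<xi> x < a"
      using \<tau> by (auto simp: eventually_at_right_field intro: exI[of _ \<tau>])
  qed
qed

lemma val_inf_eq_SUP:
  fixes \<xi> :: "real \<Rightarrow> ennreal"
  assumes mono: "\<And>a b. 0 < a \<Longrightarrow> a \<le> b \<Longrightarrow> \<xi> a \<le> \<xi> b"
  shows "val_inf \<xi> = (SUP \<tau>\<in>{0<..}. \<xi> \<tau>)"
  unfolding val_inf_def
proof (rule tendsto_Lim)
  show "at_top \<noteq> (bot :: real filter)" by simp
  show "(\<xi> \<longlongrightarrow> (SUP \<tau>\<in>{0<..}. \<xi> \<tau>)) at_top"
  proof (rule order_tendstoI)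
    fix a assume "(SUP \<tau>\<in>{0<..}. \<xi> \<tau>) < a"
    then have "\<xi> \<tau> < a" if "\<tau> > 0" for \<tau>
      using that by (meson SUP_upper greaterThan_iff le_less_trans)
    then show "\<forall>\<^sub>F x in at_top. \<xi> x < a"
      by (intro eventually_mono[OF eventually_gt_at_top[of 0]])
  next
    fix a assume "a < (SUP \<tau>\<in>{0<..}. \<xi> \<tau>)"
    then obtain \<tau> where \<tau>: "\<tau> > 0" "a < \<xi> \<tau>" by (auto simp: less_SUP_iff)
    then have "a < \<xi> x" if "\<tau> \<le> x" for x
      using mono[of \<tau> x] that by auto
    then show "\<forall>\<^sub>F x in at_top. a < \<xi> x"
      by (intro eventually_mono[OF eventually_ge_at_top[of \<tau>]])
  qed
qed

text \<open>A non-decreasing function with \<open>\<xi> \<tau> / \<tau>\<close> non-increasing cannot jump: enlarging the argument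
  by a factor \<open>r\<close> enlarges the value at most by \<open>r\<close>. Hence it attains every intermediate value, and
  the generalized reverse function is a genuine right inverse.\<close>

lemma gen_reverse_right_inverse:
  fixes \<xi> :: "real \<Rightarrow> ennreal"
  assumes mono: "\<And>a b. 0 < a \<Longrightarrow> a \<le> b \<Longrightarrow> \<xi> a \<le> \<xi> b"
    and fin: "\<And>a. 0 < a \<Longrightarrow> \<xi> a < \<infinity>"
    and dil: "\<And>a r. 0 < a \<Longrightarrow> 1 \<le> r \<Longrightarrow> \<xi> (r * a) \<le> ennreal r * \<xi> a"
    and t: "val_0 \<xi> < ennreal t" "ennreal t < val_inf \<xi>"
  shows "0 < gen_reverse \<xi> t" and "\<xi> (gen_reverse \<xi> t) = ennreal t"
proof -
  define S where "S = {\<tau>. 0 < \<tau> \<and> \<xi> \<tau> > ennreal t}"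
  define p where "p = gen_reverse \<xi> t"
  have p: "p = Inf S" by (simp add: p_def gen_reverse_def S_def)
  have tpos: "t > 0" using t(1) by (metis ennreal_neg not_less not_less_zero)
  obtain a where a: "0 < a" "\<xi> a < ennreal t"
    using t(1) val_0_eq_INF[of \<xi>] mono by (auto simp: INF_less_iff)
  obtain b where b: "0 < b" "ennreal t < \<xi> b"
    using t(2) val_inf_eq_SUP[of \<xi>] mono by (auto simp: less_SUP_iff)
  have "b \<in> S" using b by (simp add: S_def)
  have lower: "x \<le> \<tau>" if "0 < x" "\<xi> x \<le> ennreal t" "\<tau> \<in> S" for x \<tau>
  proof (rule ccontr)
    assume "\<not> x \<le> \<tau>"
    then have "\<xi> \<tau> \<le> \<xi> x" using mono[of \<tau> x] that by (auto simp: S_def)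
    then show False using that by (auto simp: S_def)
  qed
  have le_p: "x \<le> p" if "0 < x" "\<xi> x \<le> ennreal t" for x
    unfolding p using \<open>b \<in> S\<close> lower that by (intro cInf_greatest) auto
  have p_le: "p \<le> \<tau>" if "\<tau> \<in> S" for \<tau>
    unfolding p using that by (intro cInf_lower bdd_belowI[of _ 0]) (auto simp: S_def)
  have ppos: "0 < p" using le_p[of a] a by (auto simp: less_imp_le)
  define y where "y = enn2real (\<xi> p)"
  have y: "\<xi> p = ennreal y" "y \<ge> 0" using fin[OF ppos] by (auto simp: y_def)
  have "\<not> t < y"
  proof
    assume less: "t < y"
    define r where "r = (t + y) / (2 * t)"
    have r: "r > 1" "r * t < y" using less tpos by (auto simp: r_def field_simps)
    have q: "0 < p / r" "p / r < p" using r ppos by (auto simp: field_simps)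
    have "\<not> \<xi> (p / r) > ennreal t"
      using p_le[of "p / r"] q by (auto simp: S_def)
    then have "\<xi> (p / r) \<le> ennreal t" by simp
    then have "ennreal r * \<xi> (p / r) \<le> ennreal r * ennreal t" by (rule mult_left_mono) simp
    moreover have "\<xi> p \<le> ennreal r * \<xi> (p / r)" using dil[OF q(1), of r] r by simp
    ultimately have "ennreal y \<le> ennreal (r * t)"
      using r tpos y by (simp add: ennreal_mult)
    then show False using r tpos by (simp add: ennreal_le_iff)
  qed
  moreover have "\<not> y < t"
  proof
    assume less: "y < t"
    \<comment> \<open>Any factor \<open>r > 1\<close> with \<open>r y \<le> t\<close> serves; the midpoint quotient needs \<open>y \<noteq> 0\<close>.\<close>
    define r where "r = (if y = 0 then 2 else (t + y) / (2 * y))"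
    have r: "r > 1" "r * y \<le> t" using less y tpos by (auto simp: r_def field_simps)
    have "\<xi> (r * p) \<le> ennreal (r * y)"
      using dil[OF ppos, of r] r y by (simp add: ennreal_mult)
    also have "\<dots> \<le> ennreal t" using r by (simp add: ennreal_leI)
    finally have "r * p \<le> p" using r ppos by (intro le_p) auto
    then show False using r ppos by simp
  qed
  ultimately show "0 < gen_reverse \<xi> t" "\<xi> (gen_reverse \<xi> t) = ennreal t"
    using ppos y by (auto simp: p_def)
qed

section \<open>The K-functional of a couple of seminorms\<close>

locale extended_seminorm =
  fixes X :: "('a \<Rightarrow> 'k::ab_group_add) \<Rightarrow> ennreal"
  assumes zero: "X (\<lambda>_. 0) = 0"
    and uminus: "X (\<lambda>x. - f x) = X f"
    and add: "X (\<lambda>x. f x + g x) \<le> X f + X g"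

lemma (in banach_function_norm) extended_seminorm_bfs_norm:
  "extended_seminorm (bfs_norm M \<rho> :: ('a \<Rightarrow> 'k::{real_normed_field,euclidean_space}) \<Rightarrow> ennreal)"
proof
  show "bfs_norm M \<rho> (\<lambda>_. 0 :: 'k) = 0"
    by (simp add: bfs_norm_def eq_0_iff)
next
  fix f :: "'a \<Rightarrow> 'k"
  have "(\<lambda>x. - f x) \<in> borel_measurable M \<longleftrightarrow> f \<in> borel_measurable M"
    using borel_measurable_uminus[of "\<lambda>x. - f x" M] borel_measurable_uminus[of f M] by auto
  then show "bfs_norm M \<rho> (\<lambda>x. - f x) = bfs_norm M \<rho> f"
    by (simp add: bfs_norm_def)
next
  fix f g :: "'a \<Rightarrow> 'k"
  show "bfs_norm M \<rho> (\<lambda>x. f x + g x) \<le> bfs_norm M \<rho> f + bfs_norm M \<rho> g"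
  proof (cases "f \<in> borel_measurable M \<and> g \<in> borel_measurable M")
    case True
    then have [measurable]: "f \<in> borel_measurable M" "g \<in> borel_measurable M" by auto
    have "\<rho> (\<lambda>x. ennreal (norm (f x + g x))) \<le> \<rho> (\<lambda>x. ennreal (norm (f x)) + ennreal (norm (g x)))"
      by (intro mono) (auto simp: ennreal_plus[symmetric] norm_triangle_ineq
            simp del: ennreal_plus intro!: ennreal_leI)
    also have "\<dots> \<le> \<rho> (\<lambda>x. ennreal (norm (f x))) + \<rho> (\<lambda>x. ennreal (norm (g x)))"
      by (intro triangle) auto
    finally show ?thesis by (simp add: bfs_norm_def)
  qed (auto simp: bfs_norm_def)
qed

lemma K_fun_greatest:
  assumes "\<And>f1 f2. X f1 < \<infinity> \<Longrightarrow> Y f2 < \<infinity> \<Longrightarrow> f = (\<lambda>x. f1 x + f2 x) \<Longrightarrow>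
    a \<le> X f1 + ennreal t * Y f2"
  shows "a \<le> K_fun X Y f t"
  unfolding K_fun_def by (rule Inf_greatest) (auto simp: space_of_def assms)

lemma K_fun_lower:
  assumes "0 < t"
  shows "K_fun X Y (\<lambda>x. f1 x + f2 x) t \<le> X f1 + ennreal t * Y f2"
proof (cases "X f1 < \<infinity> \<and> Y f2 < \<infinity>")
  case True
  then show ?thesis unfolding K_fun_def by (intro Inf_lower) (auto simp: space_of_def)
next
  case False
  then have "X f1 + ennreal t * Y f2 = \<infinity>"
    using assms by (auto simp: less_top[symmetric] ennreal_mult_eq_top_iff)
  then show ?thesis by (metis infinity_ennreal_def top_greatest)
qed

text \<open>The infimum commutes with affine maps; in this form it turns an estimate by an arbitrary
  decomposition of \<open>f\<close> into one by the K-functional, without choosing a nearly optimal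
  decomposition (which would need a separate case when the K-functional vanishes).\<close>

lemma le_affine_K_fun:
  assumes "\<And>f1 f2. X f1 < \<infinity> \<Longrightarrow> Y f2 < \<infinity> \<Longrightarrow> f = (\<lambda>x. f1 x + f2 x) \<Longrightarrow>
      a \<le> b + (X f1 + ennreal t * Y f2) * c"
    and "c < \<infinity>" "f \<in> sum_space X Y"
  shows "a \<le> b + K_fun X Y f t * c"
proof (cases "c = 0 \<or> b = \<infinity>")
  case True
  then show ?thesis using assms(1,3) by (auto simp: sum_space_def space_of_def)
next
  case False
  then have c: "0 < c" "c < \<infinity>" "b < \<infinity>" using assms(2) by (auto simp: less_top zero_less_iff_neq_zero)
  have "(a - b) / c \<le> K_fun X Y f t"
  proof (rule K_fun_greatest)
    fix f1 f2 assume "X f1 < \<infinity>" "Y f2 < \<infinity>" "f = (\<lambda>x. f1 x + f2 x)"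
    from assms(1)[OF this] have "a - b \<le> c * (X f1 + ennreal t * Y f2)"
      using c by (subst ennreal_minus_le_iff) (auto simp: mult.commute)
    then show "(a - b) / c \<le> X f1 + ennreal t * Y f2"
      using c by (intro divide_le_posI_ennreal) auto
  qed
  then have "(a - b) / c * c \<le> K_fun X Y f t * c" by (rule mult_right_mono) simp
  also have "(a - b) / c * c = a - b"
    using c by (simp add: ennreal_divide_times ennreal_times_divide[symmetric]
        ennreal_divide_self less_top[symmetric])
  finally show ?thesis
    using c by (subst (asm) ennreal_minus_le_iff) auto
qed

lemma K_fun_mono:
  assumes "s \<le> t"
  shows "K_fun X Y f s \<le> K_fun X Y f t"
proof (rule K_fun_greatest)
  fix f1 f2 assume "X f1 < \<infinity>" "Y f2 < \<infinity>" "f = (\<lambda>x. f1 x + f2 x)"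
  then have "K_fun X Y f s \<le> X f1 + ennreal s * Y f2"
    unfolding K_fun_def by (intro Inf_lower) (auto simp: space_of_def)
  also have "\<dots> \<le> X f1 + ennreal t * Y f2"
    using assms by (intro add_left_mono mult_right_mono ennreal_leI) auto
  finally show "K_fun X Y f s \<le> X f1 + ennreal t * Y f2" .
qed

lemma K_fun_finite:
  assumes "f \<in> sum_space X Y"
  shows "K_fun X Y f t < top"
proof -
  obtain f1 f2 where f: "X f1 < \<infinity>" "Y f2 < \<infinity>" "f = (\<lambda>x. f1 x + f2 x)"
    using assms by (auto simp: sum_space_def space_of_def)
  then have "K_fun X Y f t \<le> X f1 + ennreal t * Y f2"
    unfolding K_fun_def by (intro Inf_lower) (auto simp: space_of_def)
  also have "\<dots> < top" using f by (auto simp: ennreal_mult_less_top)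
  finally show ?thesis .
qed

lemma K_fun_dilate:
  assumes "0 < s" "s \<le> t" "f \<in> sum_space X Y"
  shows "ennreal s * K_fun X Y f t \<le> ennreal t * K_fun X Y f s"
proof -
  have "ennreal s * K_fun X Y f t \<le> 0 + K_fun X Y f s * ennreal t"
  proof (rule le_affine_K_fun)
    fix f1 f2 assume "X f1 < \<infinity>" "Y f2 < \<infinity>" "f = (\<lambda>x. f1 x + f2 x)"
    then have "ennreal s * K_fun X Y f t \<le> ennreal s * (X f1 + ennreal t * Y f2)"
      using K_fun_lower[of t X Y f1 f2] assms by (intro mult_left_mono) auto
    also have "\<dots> \<le> ennreal t * X f1 + ennreal s * ennreal t * Y f2"
      using assms by (auto simp: distrib_left mult.assoc intro!: add_mono mult_right_mono ennreal_leI)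
    finally show "ennreal s * K_fun X Y f t \<le> 0 + (X f1 + ennreal s * Y f2) * ennreal t"
      by (simp add: distrib_left distrib_right mult_ac)
  qed (use assms in auto)
  then show ?thesis by (simp add: mult.commute)
qed

locale seminorm_couple =
  X: extended_seminorm X + Y: extended_seminorm Y
  for X Y :: "('a \<Rightarrow> 'k::ab_group_add) \<Rightarrow> ennreal"
begin

lemma sum_spaceI1: "X f < \<infinity> \<Longrightarrow> f \<in> sum_space X Y"
  using Y.zero by (force simp: sum_space_def space_of_def)

lemma sum_spaceI2: "Y f < \<infinity> \<Longrightarrow> f \<in> sum_space X Y"
  using X.zero by (force simp: sum_space_def space_of_def)

lemma sum_space_add:
  assumes "f \<in> sum_space X Y" "g \<in> sum_space X Y"
  shows "(\<lambda>x. f x + g x) \<in> sum_space X Y"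
proof -
  obtain f1 f2 g1 g2 where *: "X f1 < \<infinity>" "Y f2 < \<infinity>" "f = (\<lambda>x. f1 x + f2 x)"
     "X g1 < \<infinity>" "Y g2 < \<infinity>" "g = (\<lambda>x. g1 x + g2 x)"
    using assms by (auto simp: sum_space_def space_of_def)
  have "X (\<lambda>x. f1 x + g1 x) < \<infinity>" "Y (\<lambda>x. f2 x + g2 x) < \<infinity>"
    using X.add[of f1 g1] Y.add[of f2 g2] * by (auto intro: le_less_trans)
  moreover have "(\<lambda>x. f x + g x) = (\<lambda>x. (f1 x + g1 x) + (f2 x + g2 x))"
    using * by (auto simp: algebra_simps)
  ultimately show ?thesis by (auto simp: sum_space_def space_of_def)
qed

lemma K_fun_le_X: "0 < s \<Longrightarrow> K_fun X Y f s \<le> X f"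
  using K_fun_lower[of s X Y f "\<lambda>_. 0"] by (simp add: Y.zero)

lemma K_fun_le_Y: "0 < s \<Longrightarrow> K_fun X Y f s \<le> ennreal s * Y f"
  using K_fun_lower[of s X Y "\<lambda>_. 0" f] by (simp add: X.zero)

lemma K_fun_perturb:
  assumes "0 < s" "f \<in> sum_space X Y"
  shows "K_fun X Y (\<lambda>x. f x + (g x + h x)) s \<le> K_fun X Y f s + (X g + ennreal s * Y h)"
proof -
  have "K_fun X Y (\<lambda>x. f x + (g x + h x)) s
      \<le> (X g + ennreal s * Y h) + K_fun X Y f s * 1"
  proof (rule le_affine_K_fun)
    fix f1 f2 assume "X f1 < \<infinity>" "Y f2 < \<infinity>" "f = (\<lambda>x. f1 x + f2 x)"
    then have "(\<lambda>x. f x + (g x + h x)) = (\<lambda>x. (f1 x + g x) + (f2 x + h x))"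
      by (auto simp: algebra_simps)
    then have "K_fun X Y (\<lambda>x. f x + (g x + h x)) s
        \<le> X (\<lambda>x. f1 x + g x) + ennreal s * Y (\<lambda>x. f2 x + h x)"
      using K_fun_lower[OF assms(1)] by simp
    also have "\<dots> \<le> (X f1 + X g) + ennreal s * (Y f2 + Y h)"
      by (intro add_mono mult_left_mono X.add Y.add) auto
    finally show "K_fun X Y (\<lambda>x. f x + (g x + h x)) s
      \<le> (X g + ennreal s * Y h) + (X f1 + ennreal s * Y f2) * 1"
      by (simp add: algebra_simps)
  qed (use assms in auto)
  then show ?thesis by (simp add: add.commute)
qed

lemma K_fun_perturb_X:
  assumes "0 < s" "f \<in> sum_space X Y"
  shows "K_fun X Y (\<lambda>x. f x + g x) s \<le> K_fun X Y f s + X g"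
  using K_fun_perturb[OF assms, of g "\<lambda>_. 0"] by (simp add: Y.zero)

lemma K_fun_perturb_Y:
  assumes "0 < s" "f \<in> sum_space X Y"
  shows "K_fun X Y (\<lambda>x. f x + g x) s \<le> K_fun X Y f s + ennreal s * Y g"
  using K_fun_perturb[OF assms, of "\<lambda>_. 0" g] by (simp add: X.zero)

end

section \<open>Domination in a Banach lattice over the half-line\<close>

lemma space_dt_over_t: "space dt_over_t = {0<..}"
  by (simp add: dt_over_t_def)

lemma borel_measurable_dt_over_t:
  assumes "f \<in> borel_measurable borel"
  shows "f \<in> borel_measurable dt_over_t"
  using assms unfolding dt_over_t_def
  by (simp add: measurable_restrict_space1 measurable_completion)

lemma AE_dt_over_t_neq: "AE s in dt_over_t. s \<noteq> \<tau>"
proof -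
  have "AE s in lebesgue_on {0<..}. s \<noteq> \<tau>"
  proof -
    have "AE s in lborel. s \<noteq> \<tau>" by (rule AE_lborel_singleton)
    then have "AE s in lebesgue. s \<noteq> \<tau>" by (rule AE_completion)
    then show ?thesis by (subst AE_restrict_space_iff) auto
  qed
  moreover have "(\<lambda>t. ennreal (1 / t)) \<in> borel_measurable (lebesgue_on {0<..})"
    by (intro measurable_restrict_space1 measurable_completion) measurable
  ultimately show ?thesis unfolding dt_over_t_def
    by (subst AE_density) auto
qed

context banach_lattice
begin

lemma norm_mono:
  assumes "f \<in> borel_measurable borel" "\<And>s. 0 < s \<Longrightarrow> \<bar>f s\<bar> \<le> \<bar>g s\<bar>"
  shows "F f \<le> F g"
proof (cases "F g < \<infinity>")
  case True
  then show ?thesis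
    using assms by (intro ideal borel_measurable_dt_over_t) (auto simp: space_dt_over_t)
qed (auto simp: less_top[symmetric])

lemma norm_scale:
  assumes "F f < \<infinity>" "0 \<le> a"
  shows "F (\<lambda>s. a * f s) = ennreal a * F f"
  using scale[OF assms(1), of a] assms(2) by simp

text \<open>A single point is negligible, so the domination may fail at \<open>\<tau>\<close>; this lets a function be
  split into its parts below and above \<open>\<tau>\<close>.\<close>

lemma norm_le_add:
  assumes [measurable]: "f \<in> borel_measurable borel" "g \<in> borel_measurable borel"
      "h \<in> borel_measurable borel"
    and le: "\<And>s. 0 < s \<Longrightarrow> s \<noteq> \<tau> \<Longrightarrow> \<bar>h s\<bar> \<le> \<bar>f s\<bar> + \<bar>g s\<bar>"
  shows "F h \<le> F f + F g"
proof (cases "F f < \<infinity> \<and> F g < \<infinity>")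
  case True
  have abs: "F (\<lambda>s. \<bar>f s\<bar>) \<le> F f" "F (\<lambda>s. \<bar>g s\<bar>) \<le> F g"
    by (auto intro!: norm_mono)
  then have fin: "F (\<lambda>s. \<bar>f s\<bar>) < \<infinity>" "F (\<lambda>s. \<bar>g s\<bar>) < \<infinity>"
    using True by auto
  have sum: "F (\<lambda>s. \<bar>f s\<bar> + \<bar>g s\<bar>) \<le> F (\<lambda>s. \<bar>f s\<bar>) + F (\<lambda>s. \<bar>g s\<bar>)"
    using fin by (rule triangle)
  also have "\<dots> < \<infinity>" using fin by simp
  finally have "F h \<le> F (\<lambda>s. \<bar>f s\<bar> + \<bar>g s\<bar>)"
    using le AE_dt_over_t_neq[of \<tau>]
    by (intro ideal borel_measurable_dt_over_t) (auto simp: space_dt_over_t elim: AE_mp)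
  also note sum
  also have "F (\<lambda>s. \<bar>f s\<bar>) + F (\<lambda>s. \<bar>g s\<bar>) \<le> F f + F g"
    using abs by (rule add_mono)
  finally show ?thesis .
qed (auto simp: less_top[symmetric])

lemma Xi_mono:
  assumes "0 < a" "a \<le> b"
  shows "Xi F a \<le> Xi F b"
  unfolding Xi_def using assms by (intro norm_mono) auto

lemma Xi_dilate:
  assumes "0 < a" "1 \<le> r" "Xi F a < \<infinity>"
  shows "Xi F (r * a) \<le> ennreal r * Xi F a"
proof -
  have "Xi F (r * a) \<le> F (\<lambda>s. r * min s a)"
    unfolding Xi_def
  proof (rule norm_mono)
    fix s :: real assume "0 < s"
    then have "s * 1 \<le> s * r" using assms by (intro mult_left_mono) auto
    then have "min s (r * a) \<le> r * min s a" by (auto simp: min_def mult.commute)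
    then show "\<bar>min s (r * a)\<bar> \<le> \<bar>r * min s a\<bar>"
      using assms \<open>0 < s\<close> by (simp add: abs_mult)
  qed auto
  also have "\<dots> = ennreal r * Xi F a"
    using assms by (simp add: norm_scale Xi_def)
  finally show ?thesis .
qed

lemma Xi_finite:
  assumes "Xi F 1 < \<infinity>" "0 < a"
  shows "Xi F a < \<infinity>"
proof -
  have "Xi F a \<le> Xi F (max 1 a * 1)" using assms by (intro Xi_mono) auto
  also have "\<dots> \<le> ennreal (max 1 a) * Xi F 1" using assms by (intro Xi_dilate) auto
  also have "\<dots> < \<infinity>" using assms by (simp add: ennreal_mult_less_top)
  finally show ?thesis .
qed

text \<open>The norms of the two pieces into which \<open>min s \<tau>\<close> is cut at \<open>\<tau>\<close>, the upper one normalised to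
  height \<open>1\<close>.\<close>

definition low :: "real \<Rightarrow> ennreal" where
  "low \<tau> = F (\<lambda>s. s * indicator {0<..<\<tau>} s)"

definition upp :: "real \<Rightarrow> ennreal" where
  "upp \<tau> = F (indicator {\<tau><..})"

lemma low_le_Xi: "0 < \<tau> \<Longrightarrow> low \<tau> \<le> Xi F \<tau>"
  unfolding low_def Xi_def by (intro norm_mono) (auto simp: indicator_def)

lemma upp_le_Xi:
  assumes "0 < \<tau>" "Xi F \<tau> < \<infinity>"
  shows "upp \<tau> < \<infinity>" "ennreal \<tau> * upp \<tau> \<le> Xi F \<tau>"
proof -
  have "upp \<tau> \<le> F (\<lambda>s. inverse \<tau> * min s \<tau>)"
    unfolding upp_def using assms by (intro norm_mono) (auto simp: indicator_def)
  also have "\<dots> = ennreal (inverse \<tau>) * Xi F \<tau>"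
    using assms by (simp add: norm_scale Xi_def)
  also have "\<dots> < \<infinity>" using assms by (simp add: ennreal_mult_less_top)
  finally show fin: "upp \<tau> < \<infinity>" .
  have "ennreal \<tau> * upp \<tau> = F (\<lambda>s. \<tau> * indicator {\<tau><..} s)"
    using fin assms by (simp add: norm_scale upp_def)
  also have "\<dots> \<le> Xi F \<tau>"
    unfolding Xi_def using assms by (intro norm_mono) (auto simp: indicator_def)
  finally show "ennreal \<tau> * upp \<tau> \<le> Xi F \<tau>" .
qed

lemma Xi_le_low_upp:
  assumes "0 < \<tau>" "Xi F \<tau> < \<infinity>"
  shows "Xi F \<tau> \<le> low \<tau> + ennreal \<tau> * upp \<tau>"
proof -
  have "Xi F \<tau> \<le> low \<tau> + F (\<lambda>s. \<tau> * indicator {\<tau><..} s)"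
    unfolding Xi_def low_def using assms
    by (intro norm_le_add[where \<tau> = \<tau>]) (auto simp: indicator_def)
  then show ?thesis using upp_le_Xi[OF assms] assms
    by (simp add: norm_scale upp_def)
qed

end


text \<open>Finiteness of \<open>Theta F 1\<close> says that \<open>min s 1\<close> has nonzero norm. Then \<open>Xi F\<close> takes values
  in \<open>(0, \<infinity>)\<close>, and \<open>Theta F\<close>, the quotient of \<open>a\<close> by the quasi-concave \<open>Xi F a\<close>, is again
  quasi-concave: monotonicity and the dilation bound change places.\<close>

context
  fixes F assumes lattice: "banach_lattice F" and Xi1: "Xi F 1 < \<infinity>" and Theta1: "Theta F 1 < \<infinity>"
begin

lemma Xi_pos:
  assumes "0 < a"
  shows "0 < Xi F a"
proof -
  have "Xi F 1 \<noteq> 0" using Theta1 by (auto simp: Theta_def Xi_def)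
  moreover have "Xi F 1 \<le> ennreal (max 1 (1 / a)) * Xi F a"
  proof -
    have "Xi F 1 \<le> Xi F (max 1 (1 / a) * a)"
      using assms by (intro banach_lattice.Xi_mono[OF lattice]) (auto simp: max_def field_simps)
    also have "\<dots> \<le> ennreal (max 1 (1 / a)) * Xi F a"
      using assms banach_lattice.Xi_finite[OF lattice Xi1]
      by (intro banach_lattice.Xi_dilate[OF lattice]) auto
    finally show ?thesis .
  qed
  ultimately show ?thesis by (auto simp: zero_less_iff_neq_zero)
qed

lemma Xi_real:
  assumes "0 < a"
  obtains x where "0 < x" "Xi F a = ennreal x" "Theta F a = ennreal (a / x)"
proof -
  have "Xi F a \<noteq> top" using banach_lattice.Xi_finite[OF lattice Xi1 assms] by simp
  then obtain x where x: "0 \<le> x" "Xi F a = ennreal x" by (cases "Xi F a") auto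
  moreover have "0 < x" using Xi_pos[OF assms] x by simp
  ultimately show ?thesis
    using that assms by (simp add: Theta_def Xi_def divide_ennreal)
qed

lemma Theta_finite: "0 < a \<Longrightarrow> Theta F a < \<infinity>"
  using Xi_real[of a] by (metis ennreal_less_top infinity_ennreal_def)

lemma Theta_mono:
  assumes "0 < a" "a \<le> b"
  shows "Theta F a \<le> Theta F b"
proof -
  obtain x where x: "0 < x" "Xi F a = ennreal x" "Theta F a = ennreal (a / x)"
    using Xi_real[OF assms(1)] .
  obtain y where y: "0 < y" "Xi F b = ennreal y" "Theta F b = ennreal (b / y)"
    using Xi_real[of b] assms by auto
  have "Xi F (b / a * a) \<le> ennreal (b / a) * Xi F a"
    using assms x by (intro banach_lattice.Xi_dilate[OF lattice]) auto
  then have "ennreal y \<le> ennreal (b / a * x)"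
    using assms x y by (simp add: ennreal_mult[symmetric])
  then have "y \<le> b / a * x" using assms x by (subst (asm) ennreal_le_iff) auto
  then show ?thesis using assms x y by (auto simp: field_simps intro!: ennreal_leI)
qed

lemma Theta_dilate:
  assumes "0 < a" "1 \<le> r"
  shows "Theta F (r * a) \<le> ennreal r * Theta F a"
proof -
  obtain x where x: "0 < x" "Xi F a = ennreal x" "Theta F a = ennreal (a / x)"
    using Xi_real[OF assms(1)] .
  obtain y where y: "0 < y" "Xi F (r * a) = ennreal y" "Theta F (r * a) = ennreal (r * a / y)"
    using Xi_real[of "r * a"] assms by auto
  have "ennreal x \<le> ennreal y"
    using banach_lattice.Xi_mono[OF lattice, of a "r * a"] assms x y by simp
  then have "x \<le> y" using y by (simp add: ennreal_le_iff)
  then have "r * a / y \<le> r * (a / x)" using assms x by (simp add: frac_le)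
  then show ?thesis using assms x y by (simp add: ennreal_mult[symmetric] ennreal_leI)
qed

lemma Theta_times_Xi:
  assumes "0 < a"
  shows "Theta F a * Xi F a = ennreal a"
proof -
  obtain x where "0 < x" "Xi F a = ennreal x" "Theta F a = ennreal (a / x)"
    using Xi_real[OF assms] .
  then show ?thesis using assms by (simp add: ennreal_mult[symmetric])
qed

end

section \<open>The two-sided estimates\<close>

lemma add_mult_le_mult_add:
  fixes a b c d :: ennreal
  shows "a * c + b * d \<le> (a + b) * (c + d)"
proof -
  have "a * c + b * d \<le> (a * c + b * d) + (a * d + b * c)"
    by (rule add_increasing2) auto
  then show ?thesis by (simp add: algebra_simps)
qed

lemma ennreal_add_2_mult: "a + 2 * a = (3 :: ennreal) * a"
  by (metis distrib_right mult_1 one_plus_numeral semiring_norm(3))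

lemma equiv_constants:
  fixes A B :: ennreal
  assumes "A \<le> 3 * B" "B \<le> 2 * A"
  shows "ennreal (inverse 3) * B \<le> A \<and> A \<le> ennreal 3 * B"
proof
  have "ennreal (inverse 3) * 3 = ennreal (inverse 3) * ennreal 3" by simp
  also have "\<dots> = 1" by (subst ennreal_mult[symmetric]) auto
  finally have inv: "ennreal (inverse 3) * 3 = 1" .
  have "B \<le> 3 * A"
    using assms(2) by (rule order_trans) (auto intro: mult_right_mono)
  then have "ennreal (inverse 3) * B \<le> ennreal (inverse 3) * (3 * A)"
    by (rule mult_left_mono) simp
  also have "\<dots> = A" using inv by (simp add: mult.assoc[symmetric])
  finally show "ennreal (inverse 3) * B \<le> A" .
qed (use assms(1) in simp)

locale lattice_interpolation =
  seminorm_couple X Y + banach_lattice F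
  for X Y :: "('a \<Rightarrow> 'k::ab_group_add) \<Rightarrow> ennreal"
    and F :: "(real \<Rightarrow> real) \<Rightarrow> ennreal"
begin

abbreviation K :: "('a \<Rightarrow> 'k) \<Rightarrow> real \<Rightarrow> ennreal" where
  "K \<equiv> K_fun X Y"

abbreviation rK :: "('a \<Rightarrow> 'k) \<Rightarrow> real \<Rightarrow> real" where
  "rK f s \<equiv> enn2real (K f s)"

lemma ennreal_rK: "f \<in> sum_space X Y \<Longrightarrow> ennreal (rK f s) = K f s"
  using K_fun_finite[of f X Y s] by simp

lemma borel_measurable_rK [measurable]:
  assumes "f \<in> sum_space X Y"
  shows "rK f \<in> borel_measurable borel"
  using assms
  by (intro borel_measurable_mono monoI enn2real_mono K_fun_mono) (auto simp: K_fun_finite)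

lemma rK_le:
  assumes "f \<in> sum_space X Y" "K f s \<le> ennreal b" "0 \<le> b"
  shows "rK f s \<le> b"
  using assms by (metis ennreal_le_iff ennreal_rK)

lemma rK_mono: "f \<in> sum_space X Y \<Longrightarrow> s \<le> t \<Longrightarrow> rK f s \<le> rK f t"
  by (intro enn2real_mono K_fun_mono) (auto simp: K_fun_finite)

lemma rK_dilate:
  assumes "f \<in> sum_space X Y" "0 < s" "s \<le> t"
  shows "s * rK f t \<le> t * rK f s"
proof -
  have "ennreal (s * rK f t) \<le> ennreal (t * rK f s)"
    using K_fun_dilate[OF assms(2,3,1)] assms by (simp add: ennreal_mult ennreal_rK)
  then show ?thesis using assms by (subst (asm) ennreal_le_iff) auto
qed

lemma rK_le_X:
  assumes "X f < \<infinity>" "0 < s"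
  shows "rK f s \<le> enn2real (X f)"
  using K_fun_le_X[of s f] assms by (intro enn2real_mono) auto

lemma rK_le_Y:
  assumes "Y f < \<infinity>" "0 < s"
  shows "rK f s \<le> s * enn2real (Y f)"
  using K_fun_le_Y[of s f] assms
  by (intro rK_le sum_spaceI2) (auto simp: ennreal_mult)

lemma rK_perturb_X:
  assumes "f \<in> sum_space X Y" "X g < \<infinity>" "0 < s"
  shows "rK (\<lambda>x. f x + g x) s \<le> rK f s + enn2real (X g)"
  using K_fun_perturb_X[of s f g] assms
  by (intro rK_le sum_space_add[OF assms(1) sum_spaceI1[OF assms(2)]]) (auto simp: ennreal_rK)

lemma rK_perturb_Y:
  assumes "f \<in> sum_space X Y" "Y g < \<infinity>" "0 < s"
  shows "rK (\<lambda>x. f x + g x) s \<le> rK f s + s * enn2real (Y g)"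
  using K_fun_perturb_Y[of s f g] assms
  by (intro rK_le sum_space_add[OF assms(1) sum_spaceI2[OF assms(2)]])
    (auto simp: ennreal_rK ennreal_mult)

abbreviation Kbelow :: "('a \<Rightarrow> 'k) \<Rightarrow> real \<Rightarrow> ennreal" where
  "Kbelow f \<tau> \<equiv> F (\<lambda>s. rK f s * indicator {0<..<\<tau>} s)"

abbreviation Kabove :: "('a \<Rightarrow> 'k) \<Rightarrow> real \<Rightarrow> ennreal" where
  "Kabove f \<tau> \<equiv> F (\<lambda>s. rK f s * indicator {\<tau><..} s)"

lemma interp_norm_sum_space:
  "f \<in> sum_space X Y \<Longrightarrow> interp_norm X Y F f = F (rK f)"
  by (simp add: interp_norm_def)

lemma sum_space_if_interp_norm_finite:
  "interp_norm X Y F f < \<infinity> \<Longrightarrow> f \<in> sum_space X Y"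
  by (auto simp: interp_norm_def split: if_splits)

lemma Kbelow_le:
  assumes "f \<in> sum_space X Y"
  shows "Kbelow f \<tau> \<le> F (rK f)"
  using assms by (intro norm_mono) (auto simp: indicator_def)

lemma Kabove_le:
  assumes "f \<in> sum_space X Y"
  shows "Kabove f \<tau> \<le> F (rK f)"
  using assms by (intro norm_mono) (auto simp: indicator_def)

text \<open>Because \<open>K f s / s\<close> is non-increasing, the line through the origin and \<open>(\<tau>, K f \<tau>)\<close> stays below
  \<open>K f\<close> on \<open>(0, \<tau>)\<close>; this absorbs the terms with \<open>low \<tau>\<close> in the upper bounds.\<close>

lemma K_low_le_Kbelow:
  assumes "f \<in> sum_space X Y" "0 < \<tau>" "Xi F \<tau> < \<infinity>"
  shows "K f \<tau> * low \<tau> \<le> ennreal \<tau> * Kbelow f \<tau>"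
proof (cases "Kbelow f \<tau> < \<infinity>")
  case True
  have "low \<tau> < \<infinity>" using low_le_Xi[OF assms(2)] assms(3) by (rule le_less_trans)
  then have "K f \<tau> * low \<tau> = F (\<lambda>s. rK f \<tau> * (s * indicator {0<..<\<tau>} s))"
    using assms by (simp add: low_def norm_scale ennreal_rK)
  also have "\<dots> \<le> F (\<lambda>s. \<tau> * (rK f s * indicator {0<..<\<tau>} s))"
    using assms rK_dilate[OF assms(1), of _ \<tau>]
    by (intro norm_mono) (auto simp: indicator_def abs_mult mult.commute)
  also have "\<dots> = ennreal \<tau> * Kbelow f \<tau>"
    using True assms by (intro norm_scale) auto
  finally show ?thesis .
qed (use assms in \<open>auto simp: less_top[symmetric] ennreal_mult_top\<close>)

lemma K_upp_le_Kabove: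
  assumes "f \<in> sum_space X Y" "0 < \<tau>" "Xi F \<tau> < \<infinity>"
  shows "K f \<tau> * upp \<tau> \<le> Kabove f \<tau>"
proof -
  have "K f \<tau> * upp \<tau> = F (\<lambda>s. rK f \<tau> * indicator {\<tau><..} s)"
    using upp_le_Xi[OF assms(2,3)] assms by (simp add: upp_def norm_scale ennreal_rK)
  also have "\<dots> \<le> Kabove f \<tau>"
    using assms rK_mono[OF assms(1), of \<tau>]
    by (intro norm_mono) (auto simp: indicator_def)
  finally show ?thesis .
qed

lemma Kbelow_perturb:
  assumes g: "g \<in> sum_space X Y" and h: "Y h < \<infinity>" and \<tau>: "0 < \<tau>" "Xi F \<tau> < \<infinity>"
  shows "Kbelow (\<lambda>x. g x + h x) \<tau> \<le> Kbelow g \<tau> + Y h * low \<tau>"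
proof -
  let ?y = "enn2real (Y h)"
  have [measurable]: "(\<lambda>x. g x + h x) \<in> sum_space X Y" "g \<in> sum_space X Y"
    using sum_space_add[OF g sum_spaceI2[OF h]] g by auto
  have "Kbelow (\<lambda>x. g x + h x) \<tau> \<le> Kbelow g \<tau> + F (\<lambda>s. ?y * (s * indicator {0<..<\<tau>} s))"
    using rK_perturb_Y[OF g h]
    by (intro norm_le_add[where \<tau> = \<tau>]) (auto simp: indicator_def abs_mult mult.commute)
  also have "F (\<lambda>s. ?y * (s * indicator {0<..<\<tau>} s)) = Y h * low \<tau>"
    using le_less_trans[OF low_le_Xi[OF \<tau>(1)] \<tau>(2)] h by (simp add: norm_scale low_def)
  finally show ?thesis .
qed

lemma Kabove_perturb:
  assumes g: "g \<in> sum_space X Y" and h: "X h < \<infinity>" and \<tau>: "0 < \<tau>" "Xi F \<tau> < \<infinity>"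
  shows "Kabove (\<lambda>x. g x + h x) \<tau> \<le> Kabove g \<tau> + X h * upp \<tau>"
proof -
  let ?y = "enn2real (X h)"
  have [measurable]: "(\<lambda>x. g x + h x) \<in> sum_space X Y" "g \<in> sum_space X Y"
    using sum_space_add[OF g sum_spaceI1[OF h]] g by auto
  have "Kabove (\<lambda>x. g x + h x) \<tau> \<le> Kabove g \<tau> + F (\<lambda>s. ?y * indicator {\<tau><..} s)"
    using rK_perturb_X[OF g h] \<tau>
    by (intro norm_le_add[where \<tau> = \<tau>]) (auto simp: indicator_def)
  also have "F (\<lambda>s. ?y * indicator {\<tau><..} s) = X h * upp \<tau>"
    using upp_le_Xi[OF \<tau>] h by (simp add: norm_scale upp_def)
  finally show ?thesis .
qed

lemma interp_norm_le_Kbelow_Kabove: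
  assumes "f \<in> sum_space X Y"
  shows "interp_norm X Y F f \<le> Kbelow f \<tau> + Kabove f \<tau>"
  using assms unfolding interp_norm_sum_space[OF assms]
  by (intro norm_le_add[where \<tau> = \<tau>]) (auto simp: indicator_def)

lemma Kbelow_le_Y:
  assumes h: "Y h < \<infinity>" and \<tau>: "0 < \<tau>" "Xi F \<tau> < \<infinity>"
  shows "Kbelow h \<tau> \<le> Y h * low \<tau>"
proof -
  let ?y = "enn2real (Y h)"
  have [measurable]: "h \<in> sum_space X Y" using h by (rule sum_spaceI2)
  have "Kbelow h \<tau> \<le> F (\<lambda>s. ?y * (s * indicator {0<..<\<tau>} s))"
    using rK_le_Y[OF h] by (intro norm_mono) (auto simp: indicator_def abs_mult mult.commute)
  also have "\<dots> = Y h * low \<tau>"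
    using le_less_trans[OF low_le_Xi[OF \<tau>(1)] \<tau>(2)] h by (simp add: norm_scale low_def)
  finally show ?thesis .
qed

lemma Kabove_le_X:
  assumes h: "X h < \<infinity>" and \<tau>: "0 < \<tau>" "Xi F \<tau> < \<infinity>"
  shows "Kabove h \<tau> \<le> X h * upp \<tau>"
proof -
  let ?y = "enn2real (X h)"
  have [measurable]: "h \<in> sum_space X Y" using h by (rule sum_spaceI1)
  have "Kabove h \<tau> \<le> F (\<lambda>s. ?y * indicator {\<tau><..} s)"
    using rK_le_X[OF h] \<tau> by (intro norm_mono) (auto simp: indicator_def)
  also have "\<dots> = X h * upp \<tau>"
    using upp_le_Xi[OF \<tau>] h by (simp add: norm_scale upp_def)
  finally show ?thesis .
qed

text \<open>A decomposition of \<open>f\<close> into \<open>f0\<close> in \<open>X\<close> and \<open>f1\<close> in \<open>Y\<close> is tested in the new couple. Below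
  \<open>\<tau>\<close> the piece \<open>f0 = f - f1\<close> is compared with \<open>f\<close>, above \<open>\<tau>\<close> it is estimated by its own norm.
  The factor \<open>?C\<close> collects what multiplies the cost of the decomposition at \<open>\<tau>\<close>.\<close>

lemma K_interp_Y_le:
  assumes f: "f \<in> sum_space X Y" and \<tau>: "0 < \<tau>" "Xi F \<tau> < \<infinity>"
    and t: "0 < t" "ennreal t = Xi F \<tau>"
  shows "K_fun (interp_norm X Y F) Y f t \<le> 3 * (Kbelow f \<tau> + K f \<tau> * upp \<tau>)"
proof -
  define i where "i = ennreal (inverse \<tau>)"
  have i: "ennreal \<tau> * i = 1" using \<tau> by (simp add: i_def ennreal_mult[symmetric])
  have low: "low \<tau> < \<infinity>" using low_le_Xi[OF \<tau>(1)] \<tau>(2) by (rule le_less_trans)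
  have upp: "upp \<tau> < \<infinity>" using upp_le_Xi[OF \<tau>] by simp
  let ?C = "upp \<tau> + (low \<tau> + Xi F \<tau>) * i"
  have "K_fun (interp_norm X Y F) Y f t \<le> Kbelow f \<tau> + K f \<tau> * ?C"
  proof (rule le_affine_K_fun[OF _ _ f])
    show "?C < \<infinity>" using low upp \<tau> by (simp add: i_def ennreal_mult_less_top)
    fix f0 f1 assume f0: "X f0 < \<infinity>" and f1: "Y f1 < \<infinity>" and eq: "f = (\<lambda>x. f0 x + f1 x)"
    have "(\<lambda>x. f x + - f1 x) = f0" using eq by auto
    then have below: "Kbelow f0 \<tau> \<le> Kbelow f \<tau> + Y f1 * low \<tau>"
      using Kbelow_perturb[OF f _ \<tau>, of "\<lambda>x. - f1 x"] f1 by (simp add: Y.uminus)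
    have "K_fun (interp_norm X Y F) Y f t \<le> interp_norm X Y F f0 + ennreal t * Y f1"
      unfolding eq using t(1) by (rule K_fun_lower)
    also have "\<dots> \<le> ((Kbelow f \<tau> + Y f1 * low \<tau>) + X f0 * upp \<tau>) + Xi F \<tau> * Y f1"
      using interp_norm_le_Kbelow_Kabove[OF sum_spaceI1[OF f0], of \<tau>] below
        Kabove_le_X[OF f0 \<tau>] unfolding t(2)
      by (intro add_right_mono) (meson add_mono order_trans)
    also have "\<dots> = Kbelow f \<tau> + (X f0 * upp \<tau> + (ennreal \<tau> * i) * (Y f1 * (low \<tau> + Xi F \<tau>)))"
      unfolding i by (simp add: algebra_simps)
    also have "\<dots> = Kbelow f \<tau> + (X f0 * upp \<tau> + (ennreal \<tau> * Y f1) * ((low \<tau> + Xi F \<tau>) * i))"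
      by (simp add: mult_ac)
    also have "\<dots> \<le> Kbelow f \<tau> + (X f0 + ennreal \<tau> * Y f1) * ?C"
      by (intro add_left_mono add_mult_le_mult_add)
    finally show "K_fun (interp_norm X Y F) Y f t \<le> Kbelow f \<tau> + (X f0 + ennreal \<tau> * Y f1) * ?C" .
  qed
  also have "\<dots> \<le> 3 * (Kbelow f \<tau> + K f \<tau> * upp \<tau>)"
  proof -
    have "K f \<tau> * ?C \<le> K f \<tau> * (upp \<tau> + (low \<tau> + (low \<tau> + ennreal \<tau> * upp \<tau>)) * i)"
      by (intro mult_left_mono mult_right_mono add_left_mono Xi_le_low_upp \<tau>) auto
    also have "\<dots> = 2 * (i * (K f \<tau> * low \<tau>)) + (1 + ennreal \<tau> * i) * (K f \<tau> * upp \<tau>)"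
      by (simp add: algebra_simps flip: mult_2)
    also have "\<dots> \<le> 2 * (i * (ennreal \<tau> * Kbelow f \<tau>)) + (1 + ennreal \<tau> * i) * (K f \<tau> * upp \<tau>)"
      by (intro add_right_mono mult_left_mono K_low_le_Kbelow f \<tau>) auto
    also have "\<dots> = 2 * Kbelow f \<tau> + 2 * (K f \<tau> * upp \<tau>)"
      using i by (simp add: mult.assoc[symmetric] mult.commute[of i])
    finally have "Kbelow f \<tau> + K f \<tau> * ?C
        \<le> Kbelow f \<tau> + (2 * Kbelow f \<tau> + 2 * (K f \<tau> * upp \<tau>))"
      by (rule add_left_mono)
    also have "\<dots> = 3 * Kbelow f \<tau> + 2 * (K f \<tau> * upp \<tau>)"
      by (simp add: add.assoc[symmetric] ennreal_add_2_mult)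
    also have "\<dots> \<le> 3 * Kbelow f \<tau> + 3 * (K f \<tau> * upp \<tau>)"
      by (intro add_left_mono mult_right_mono) auto
    finally show ?thesis by (simp add: distrib_left)
  qed
  finally show ?thesis .
qed

text \<open>Conversely, for any decomposition into \<open>g\<close> with finite interpolation norm and \<open>h\<close> in \<open>Y\<close>, the
  summand \<open>h\<close> raises \<open>K f s\<close> below \<open>\<tau>\<close> by at most \<open>s * Y h\<close>, and \<open>K f \<tau>\<close> by at most \<open>\<tau> * Y h\<close>.
  Both multiples of \<open>Y h\<close> lie under \<open>min s \<tau>\<close> on the side of \<open>\<tau>\<close> where they occur, so each
  costs at most \<open>Xi F \<tau> * Y h = t * Y h\<close>.\<close>

lemma K_interp_Y_ge:
  assumes f: "f \<in> sum_space (interp_norm X Y F) Y" and \<tau>: "0 < \<tau>" "Xi F \<tau> < \<infinity>"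
    and t: "ennreal t = Xi F \<tau>"
  shows "Kbelow f \<tau> + K f \<tau> * upp \<tau> \<le> 2 * K_fun (interp_norm X Y F) Y f t"
proof -
  have "Kbelow f \<tau> + K f \<tau> * upp \<tau> \<le> 0 + K_fun (interp_norm X Y F) Y f t * 2"
  proof (rule le_affine_K_fun[OF _ _ f])
    fix g h assume g: "interp_norm X Y F g < \<infinity>" and h: "Y h < \<infinity>" and eq: "f = (\<lambda>x. g x + h x)"
    have gs: "g \<in> sum_space X Y" by (rule sum_space_if_interp_norm_finite[OF g])
    note g_eq = interp_norm_sum_space[OF gs]
    have "Kbelow f \<tau> \<le> Kbelow g \<tau> + Y h * low \<tau>"
      unfolding eq by (rule Kbelow_perturb[OF gs h \<tau>])
    also have "\<dots> \<le> interp_norm X Y F g + Y h * Xi F \<tau>"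
      unfolding g_eq by (intro add_mono mult_left_mono Kbelow_le gs low_le_Xi \<tau>) auto
    finally have below: "Kbelow f \<tau> \<le> interp_norm X Y F g + Y h * Xi F \<tau>" .
    have "K f \<tau> * upp \<tau> \<le> (K g \<tau> + ennreal \<tau> * Y h) * upp \<tau>"
      unfolding eq by (intro mult_right_mono K_fun_perturb_Y gs \<tau>) auto
    also have "\<dots> = K g \<tau> * upp \<tau> + Y h * (ennreal \<tau> * upp \<tau>)"
      by (simp add: algebra_simps)
    also have "\<dots> \<le> interp_norm X Y F g + Y h * Xi F \<tau>"
      using K_upp_le_Kabove[OF gs \<tau>] Kabove_le[OF gs] unfolding g_eq
      by (intro add_mono mult_left_mono upp_le_Xi \<tau>) (auto intro: order_trans)
    finally show "Kbelow f \<tau> + K f \<tau> * upp \<tau> \<le> 0 + (interp_norm X Y F g + ennreal t * Y h) * 2"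
      using add_mono[OF below] unfolding t by (simp add: mult_2_right mult.commute[of "Xi F \<tau>"])
  qed simp
  then show ?thesis by (simp add: mult.commute)
qed

text \<open>The mirror image of \<open>K_interp_Y_le\<close>: now \<open>f1 = f - f0\<close> is compared with \<open>f\<close> above \<open>\<tau>\<close> and
  estimated by its own norm below. The bare term \<open>X f0\<close> contributes the \<open>1\<close> in \<open>?C\<close>, which is
  absorbed by writing it as \<open>t * Xi F \<tau> / \<tau>\<close>.\<close>

lemma K_X_interp_le:
  assumes f: "f \<in> sum_space X Y" and \<tau>: "0 < \<tau>" "Xi F \<tau> < \<infinity>"
    and t: "0 < t" "ennreal t * Xi F \<tau> = ennreal \<tau>"
  shows "K_fun X (interp_norm X Y F) f t
    \<le> 3 * (ennreal t * (K f \<tau> / ennreal \<tau>) * low \<tau> + ennreal t * Kabove f \<tau>)"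
proof -
  define i where "i = ennreal (inverse \<tau>)"
  have i: "ennreal \<tau> * i = 1" using \<tau> by (simp add: i_def ennreal_mult[symmetric])
  have K_div: "K f \<tau> / ennreal \<tau> = K f \<tau> * i"
    using \<tau> by (simp add: divide_ennreal_def inverse_ennreal i_def)
  have low: "low \<tau> < \<infinity>" using low_le_Xi[OF \<tau>(1)] \<tau>(2) by (rule le_less_trans)
  have upp: "upp \<tau> < \<infinity>" using upp_le_Xi[OF \<tau>] by simp
  let ?C = "(1 + ennreal t * upp \<tau>) + ennreal t * low \<tau> * i"
  have "K_fun X (interp_norm X Y F) f t \<le> ennreal t * Kabove f \<tau> + K f \<tau> * ?C"
  proof (rule le_affine_K_fun[OF _ _ f])
    show "?C < \<infinity>" using low upp \<tau> by (simp add: i_def ennreal_mult_less_top)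
    fix f0 f1 assume f0: "X f0 < \<infinity>" and f1: "Y f1 < \<infinity>" and eq: "f = (\<lambda>x. f0 x + f1 x)"
    have "(\<lambda>x. f x + - f0 x) = f1" using eq by auto
    then have above: "Kabove f1 \<tau> \<le> Kabove f \<tau> + X f0 * upp \<tau>"
      using Kabove_perturb[OF f _ \<tau>, of "\<lambda>x. - f0 x"] f0 by (simp add: X.uminus)
    have "K_fun X (interp_norm X Y F) f t \<le> X f0 + ennreal t * interp_norm X Y F f1"
      unfolding eq using t(1) by (rule K_fun_lower)
    also have "\<dots> \<le> X f0 + ennreal t * (Y f1 * low \<tau> + (Kabove f \<tau> + X f0 * upp \<tau>))"
      using interp_norm_le_Kbelow_Kabove[OF sum_spaceI2[OF f1], of \<tau>] above
        Kbelow_le_Y[OF f1 \<tau>]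
      by (intro add_left_mono mult_left_mono) (auto intro: add_mono order_trans)
    also have "\<dots> = ennreal t * Kabove f \<tau>
        + (X f0 * (1 + ennreal t * upp \<tau>) + (ennreal \<tau> * i) * (Y f1 * (ennreal t * low \<tau>)))"
      unfolding i by (simp add: algebra_simps)
    also have "\<dots> = ennreal t * Kabove f \<tau>
        + (X f0 * (1 + ennreal t * upp \<tau>) + (ennreal \<tau> * Y f1) * (ennreal t * low \<tau> * i))"
      by (simp add: mult_ac)
    also have "\<dots> \<le> ennreal t * Kabove f \<tau> + (X f0 + ennreal \<tau> * Y f1) * ?C"
      by (intro add_left_mono add_mult_le_mult_add)
    finally show "K_fun X (interp_norm X Y F) f t
      \<le> ennreal t * Kabove f \<tau> + (X f0 + ennreal \<tau> * Y f1) * ?C" .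
  qed
  also have "\<dots> \<le> 3 * (ennreal t * (K f \<tau> / ennreal \<tau>) * low \<tau> + ennreal t * Kabove f \<tau>)"
  proof -
    let ?P = "ennreal t * (K f \<tau> * i) * low \<tau>" and ?Q = "ennreal t * Kabove f \<tau>"
    have "1 = ennreal t * Xi F \<tau> * i" by (simp add: t(2) i)
    also have "\<dots> \<le> ennreal t * (low \<tau> + ennreal \<tau> * upp \<tau>) * i"
      by (intro mult_left_mono mult_right_mono Xi_le_low_upp \<tau>) auto
    also have "\<dots> = ennreal t * low \<tau> * i + (ennreal \<tau> * i) * (ennreal t * upp \<tau>)"
      by (simp add: algebra_simps)
    also have "\<dots> = ennreal t * low \<tau> * i + ennreal t * upp \<tau>" by (simp add: i)
    finally have "?C \<le> ((ennreal t * low \<tau> * i + ennreal t * upp \<tau>) + ennreal t * upp \<tau>)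
        + ennreal t * low \<tau> * i"
      by (intro add_right_mono)
    also have "\<dots> = 2 * (ennreal t * low \<tau> * i) + 2 * (ennreal t * upp \<tau>)"
      by (simp add: mult_2 algebra_simps)
    finally have "K f \<tau> * ?C \<le> K f \<tau> * (2 * (ennreal t * low \<tau> * i) + 2 * (ennreal t * upp \<tau>))"
      by (rule mult_left_mono) simp
    also have "\<dots> = 2 * ?P + 2 * (ennreal t * (K f \<tau> * upp \<tau>))"
      by (simp add: algebra_simps)
    also have "\<dots> \<le> 2 * ?P + 2 * ?Q"
      by (intro add_left_mono mult_left_mono K_upp_le_Kabove f \<tau>) auto
    finally have "?Q + K f \<tau> * ?C \<le> ?Q + (2 * ?Q + 2 * ?P)"
      by (simp add: add.commute add_left_mono)
    also have "\<dots> = 3 * ?Q + 2 * ?P"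
      by (simp add: add.assoc[symmetric] ennreal_add_2_mult)
    also have "\<dots> \<le> 3 * ?Q + 3 * ?P"
      by (intro add_left_mono mult_right_mono) auto
    finally show ?thesis by (simp add: K_div distrib_left add.commute)
  qed
  finally show ?thesis .
qed

text \<open>Here \<open>X g\<close> is the norm of a summand that raises \<open>K f s\<close> by a constant. The normalisation
  \<open>t * Xi F \<tau> = \<tau>\<close> makes both weights multiplying it at most \<open>1\<close>.\<close>

lemma K_X_interp_ge:
  assumes f: "f \<in> sum_space X (interp_norm X Y F)" and \<tau>: "0 < \<tau>" "Xi F \<tau> < \<infinity>"
    and t: "0 < t" "ennreal t * Xi F \<tau> = ennreal \<tau>"
  shows "ennreal t * (K f \<tau> / ennreal \<tau>) * low \<tau> + ennreal t * Kabove f \<tau>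
    \<le> 2 * K_fun X (interp_norm X Y F) f t"
proof -
  define i where "i = ennreal (inverse \<tau>)"
  have i: "ennreal \<tau> * i = 1" using \<tau> by (simp add: i_def ennreal_mult[symmetric])
  have K_div: "K f \<tau> / ennreal \<tau> = K f \<tau> * i"
    using \<tau> by (simp add: divide_ennreal_def inverse_ennreal i_def)
  have "ennreal t * i * low \<tau> \<le> ennreal t * i * Xi F \<tau>"
    by (intro mult_left_mono low_le_Xi \<tau>) auto
  also have "\<dots> = 1" using i t(2) by (metis mult.assoc mult.commute)
  finally have low: "ennreal t * i * low \<tau> \<le> 1" .
  have "ennreal t * upp \<tau> = ennreal t * i * (ennreal \<tau> * upp \<tau>)"
    using i by (metis mult.assoc mult.commute mult.left_neutral)
  also have "\<dots> \<le> ennreal t * i * Xi F \<tau>"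
    by (intro mult_left_mono upp_le_Xi \<tau>) auto
  also have "\<dots> = 1" using i t(2) by (metis mult.assoc mult.commute)
  finally have upp: "ennreal t * upp \<tau> \<le> 1" .
  have "ennreal t * (K f \<tau> / ennreal \<tau>) * low \<tau> + ennreal t * Kabove f \<tau>
    \<le> 0 + K_fun X (interp_norm X Y F) f t * 2"
  proof (rule le_affine_K_fun[OF _ _ f])
    fix g h assume g: "X g < \<infinity>" and h: "interp_norm X Y F h < \<infinity>" and "f = (\<lambda>x. g x + h x)"
    then have eq: "f = (\<lambda>x. h x + g x)" by (simp add: add.commute)
    have hs: "h \<in> sum_space X Y" by (rule sum_space_if_interp_norm_finite[OF h])
    note h_eq = interp_norm_sum_space[OF hs]
    have "ennreal t * (K f \<tau> / ennreal \<tau>) * low \<tau> = (ennreal t * i * low \<tau>) * K f \<tau>"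
      by (simp add: K_div mult_ac)
    also have "\<dots> \<le> (ennreal t * i * low \<tau>) * (K h \<tau> + X g)"
      unfolding eq by (intro mult_left_mono K_fun_perturb_X hs \<tau>) auto
    also have "\<dots> = (ennreal t * i * low \<tau>) * X g + ennreal t * i * (K h \<tau> * low \<tau>)"
      by (simp add: algebra_simps)
    also have "\<dots> \<le> 1 * X g + ennreal t * i * (ennreal \<tau> * Kbelow h \<tau>)"
      by (intro add_mono mult_left_mono mult_right_mono low K_low_le_Kbelow hs \<tau>) auto
    also have "ennreal t * i * (ennreal \<tau> * Kbelow h \<tau>) = (ennreal \<tau> * i) * (ennreal t * Kbelow h \<tau>)"
      by (simp add: mult_ac)
    also have "1 * X g + \<dots> \<le> X g + ennreal t * interp_norm X Y F h"
      unfolding i h_eq by (simp add: add_left_mono mult_left_mono Kbelow_le hs)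
    finally have below: "ennreal t * (K f \<tau> / ennreal \<tau>) * low \<tau>
      \<le> X g + ennreal t * interp_norm X Y F h" .
    have "ennreal t * Kabove f \<tau> \<le> ennreal t * (Kabove h \<tau> + X g * upp \<tau>)"
      unfolding eq by (intro mult_left_mono Kabove_perturb hs g \<tau>) auto
    also have "\<dots> = (ennreal t * upp \<tau>) * X g + ennreal t * Kabove h \<tau>"
      by (simp add: algebra_simps)
    also have "\<dots> \<le> 1 * X g + ennreal t * interp_norm X Y F h"
      unfolding h_eq by (intro add_mono mult_left_mono mult_right_mono upp Kabove_le hs) auto
    finally show "ennreal t * (K f \<tau> / ennreal \<tau>) * low \<tau> + ennreal t * Kabove f \<tau>
      \<le> 0 + (X g + ennreal t * interp_norm X Y F h) * 2"
      using add_mono[OF below] by (simp add: mult_2_right)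
  qed simp
  then show ?thesis by (simp add: mult.commute)
qed

lemma sum_space_interp_Y:
  assumes "f \<in> sum_space (interp_norm X Y F) Y"
  shows "f \<in> sum_space X Y"
proof -
  obtain g h where "interp_norm X Y F g < \<infinity>" "Y h < \<infinity>" "f = (\<lambda>x. g x + h x)"
    using assms by (auto simp: sum_space_def[of "interp_norm X Y F"] space_of_def)
  then show ?thesis
    by (auto intro!: sum_space_add sum_spaceI2[of h] sum_space_if_interp_norm_finite[of g])
qed

lemma sum_space_X_interp:
  assumes "f \<in> sum_space X (interp_norm X Y F)"
  shows "f \<in> sum_space X Y"
proof -
  obtain g h where "X g < \<infinity>" "interp_norm X Y F h < \<infinity>" "f = (\<lambda>x. g x + h x)"
    using assms by (auto simp: sum_space_def[of X "interp_norm X Y F"] space_of_def)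
  then show ?thesis
    by (auto intro!: sum_space_add sum_spaceI1[of g] sum_space_if_interp_norm_finite[of h])
qed

lemma K_interp_Y_equiv:
  assumes fin: "Xi F 1 < \<infinity>" and f: "f \<in> sum_space (interp_norm X Y F) Y"
    and t: "val_0 (Xi F) < ennreal t" "ennreal t < val_inf (Xi F)"
    and \<tau>: "\<tau> = gen_reverse (Xi F) t"
    and A: "A = K_fun (interp_norm X Y F) Y f t"
    and B: "B = Kbelow f \<tau> + K f \<tau> * F (indicator {\<tau><..})"
  shows "ennreal (inverse 3) * B \<le> A \<and> A \<le> ennreal 3 * B"
proof -
  note rev = gen_reverse_right_inverse[of "Xi F", OF Xi_mono Xi_finite[OF fin]
    Xi_dilate[OF _ _ Xi_finite[OF fin]] t, folded \<tau>]
  have pos: "0 < \<tau>" and eq: "ennreal t = Xi F \<tau>" using rev by auto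
  have "0 < t" using t(1) by (metis ennreal_neg not_less not_less_zero)
  have "A \<le> 3 * B"
    using K_interp_Y_le[OF sum_space_interp_Y[OF f] pos Xi_finite[OF fin pos] \<open>0 < t\<close> eq]
    by (simp add: A B upp_def)
  moreover have "B \<le> 2 * A"
    using K_interp_Y_ge[OF f pos Xi_finite[OF fin pos] eq] by (simp add: A B upp_def)
  ultimately show ?thesis by (rule equiv_constants)
qed

lemma K_X_interp_equiv:
  assumes fin: "Xi F 1 < \<infinity>" "Theta F 1 < \<infinity>" and f: "f \<in> sum_space X (interp_norm X Y F)"
    and t: "val_0 (Theta F) < ennreal t" "ennreal t < val_inf (Theta F)"
    and \<tau>: "\<tau> = gen_reverse (Theta F) t"
    and A: "A = K_fun X (interp_norm X Y F) f t"
    and B: "B = ennreal t * (K f \<tau> / ennreal \<tau>) * F (\<lambda>s. s * indicator {0<..<\<tau>} s)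
      + ennreal t * Kabove f \<tau>"
  shows "ennreal (inverse 3) * B \<le> A \<and> A \<le> ennreal 3 * B"
proof -
  note Theta = Theta_mono[OF banach_lattice_axioms fin] Theta_finite[OF banach_lattice_axioms fin]
    Theta_dilate[OF banach_lattice_axioms fin]
  note rev = gen_reverse_right_inverse[of "Theta F", OF Theta t, folded \<tau>]
  have pos: "0 < \<tau>" and eq: "ennreal t * Xi F \<tau> = ennreal \<tau>"
    using rev Theta_times_Xi[OF banach_lattice_axioms fin, of \<tau>] by auto
  have "0 < t" using t(1) by (metis ennreal_neg not_less not_less_zero)
  have "A \<le> 3 * B"
    using K_X_interp_le[OF sum_space_X_interp[OF f] pos Xi_finite[OF fin(1) pos] \<open>0 < t\<close> eq]
    by (simp add: A B low_def)
  moreover have "B \<le> 2 * A"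
    using K_X_interp_ge[OF f pos Xi_finite[OF fin(1) pos] \<open>0 < t\<close> eq] by (simp add: A B low_def)
  ultimately show ?thesis by (rule equiv_constants)
qed

end

theorem theorem4p1:
  fixes M :: "'a measure"
    and \<rho>0 \<rho>1 :: "('a \<Rightarrow> ennreal) \<Rightarrow> ennreal"
    and X0 X1 :: "('a \<Rightarrow> 'k::{real_normed_field,euclidean_space}) \<Rightarrow> ennreal"
  assumes "non_atomic M"
    and "banach_function_norm M \<rho>0" and "banach_function_norm M \<rho>1"
    and "X0 = bfs_norm M \<rho>0" and "X1 = bfs_norm M \<rho>1"
  shows
    "(\<forall>F0 \<phi>. banach_lattice F0 \<and> Xi F0 1 < \<infinity> \<and> \<phi> = gen_reverse (Xi F0) \<longrightarrow>
        (\<exists>c::real. c > 0 \<and>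
          (\<forall>t::real. \<forall>f\<in>sum_space (interp_norm X0 X1 F0) X1.
             val_0 (Xi F0) < ennreal t \<and> ennreal t < val_inf (Xi F0) \<longrightarrow>
             (let A = K_fun (interp_norm X0 X1 F0) X1 f t;
                  B = F0 (\<lambda>s. enn2real (K_fun X0 X1 f s) * indicator {0<..<\<phi> t} s)
                      + K_fun X0 X1 f (\<phi> t) * F0 (indicator {\<phi> t<..})
              in ennreal (inverse c) * B \<le> A \<and> A \<le> ennreal c * B)))) \<and>
     (\<forall>F1 \<psi>. banach_lattice F1 \<and> F1 (\<lambda>s. min s 1) < \<infinity> \<and> Theta F1 1 < \<infinity>
          \<and> \<psi> = gen_reverse (Theta F1) \<longrightarrow>
        (\<exists>c::real. c > 0 \<and>
          (\<forall>t::real. \<forall>f\<in>sum_space X0 (interp_norm X0 X1 F1).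
             val_0 (Theta F1) < ennreal t \<and> ennreal t < val_inf (Theta F1) \<longrightarrow>
             (let A = K_fun X0 (interp_norm X0 X1 F1) f t;
                  B = ennreal t * (K_fun X0 X1 f (\<psi> t) / ennreal (\<psi> t))
                        * F1 (\<lambda>s. s * indicator {0<..<\<psi> t} s)
                      + ennreal t * F1 (\<lambda>s. enn2real (K_fun X0 X1 f s) * indicator {\<psi> t<..} s)
              in ennreal (inverse c) * B \<le> A \<and> A \<le> ennreal c * B))))"
proof -
  interpret X: extended_seminorm X0
    unfolding assms(4) by (rule banach_function_norm.extended_seminorm_bfs_norm[OF assms(2)])
  interpret Y: extended_seminorm X1
    unfolding assms(5) by (rule banach_function_norm.extended_seminorm_bfs_norm[OF assms(3)])
  have interp: "lattice_interpolation X0 X1 F" if "banach_lattice F" for F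
    using that by (intro lattice_interpolation.intro seminorm_couple.intro
        X.extended_seminorm_axioms Y.extended_seminorm_axioms)
  show ?thesis
  proof (intro conjI allI impI, goal_cases)
    case (1 F0 \<phi>)
    then have F0: "banach_lattice F0" "Xi F0 1 < \<infinity>" and \<phi>: "\<And>t. \<phi> t = gen_reverse (Xi F0) t"
      by auto
    show ?case
      unfolding Let_def
      by (intro exI[of _ 3] conjI[OF zero_less_numeral] allI ballI impI
          lattice_interpolation.K_interp_Y_equiv[OF interp[OF F0(1)] F0(2) _ _ _ \<phi>]) auto
  next
    case (2 F1 \<psi>)
    then have F1: "banach_lattice F1" "Xi F1 1 < \<infinity>" "Theta F1 1 < \<infinity>"
      and \<psi>: "\<And>t. \<psi> t = gen_reverse (Theta F1) t"
      by (auto simp: Xi_def)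
    show ?case
      unfolding Let_def
      by (intro exI[of _ 3] conjI[OF zero_less_numeral] allI ballI impI
          lattice_interpolation.K_X_interp_equiv[OF interp[OF F1(1)] F1(2,3) _ _ _ \<psi>]) auto
  qed
qed

end
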